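(* There is a constant $c>0$ such that for every $m$ there exists a finite set $B \subset \mathbb{R}$ of size $n > m$ such that the sumset $B+B = \{b_1+b_2 : b_1,b_2 \in B\}$ contains a convex set of size at least $cn^2$.
   Context: A finite set $A=\{a_1,\dots,a_N\}$ of real numbers, listed so that $a_1 \le a_2 \le \dots \le a_N$, is called convex if the gaps between consecutive elements are strictly increasing: $a_2-a_1 < a_3-a_2 < \dots < a_N - a_{N-1}$. *)

theory Defs
  imports Complex_Main
begin

(* Indices are 0-based: the increasing enumeration of A is xs ! 0, ..., xs ! (card A - 1).
   Unrelated to convexity of subsets of real vector spaces (the library constant convex). *)
definition convex_finset :: "real set \<Rightarrow> bool" where
  "convex_finset A \<longleftrightarrow> finite A \<and>
     (let xs = sorted_list_of_set A in
        \<forall>i. i + 2 < card A \<longrightarrow> xs ! (i + 1) - xs ! i < xs ! (i + 2) - xs ! (i + 1))"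

definition sumset :: "real set \<Rightarrow> real set \<Rightarrow> real set" where
  "sumset A B = {a + b | a b. a \<in> A \<and> b \<in> B}"

end

theory Submission
  imports Defs
begin

text \<open>
  The convex set is found among the differences of squares \<open>u\<^sup>2 - (u - d)\<^sup>2 = d (2 u - d)\<close>.
  For fixed \<open>d\<close> these form an arithmetic progression in \<open>u\<close> with gap \<open>2 d\<close>, so the gaps grow
  with \<open>d\<close>. From \<open>u = (d + 1) t - 1\<close> one may pass to the progression of \<open>d + 1\<close> at
  \<open>u = d t + 1\<close>, and the gap at this transition is exactly \<open>2 d + 1\<close>, for every \<open>t\<close>. Taking
  \<open>t = 8 n\<^sup>2 div d\<close> with \<open>n < d \<le> 2 n\<close> keeps all the numbers that are squared in an
  interval of length \<open>O(n)\<close> around \<open>8 n\<^sup>2\<close>, while each progression contributes at least \<open>2 n\<close>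
  terms. The gaps are then only weakly increasing; replacing \<open>u\<^sup>2\<close> by \<open>L u\<^sup>2 + u\<^sup>3\<close> with
  \<open>L\<close> large makes them strictly increasing, since \<open>u\<^sup>3 - (u - d)\<^sup>3\<close> is strictly convex in \<open>u\<close>.
\<close>

section \<open>Convex sets from sequences with increasing gaps\<close>

lemma convex_finset_image:
  fixes f :: "nat \<Rightarrow> real"
  assumes gap_pos: "\<And>i. i + 1 < N \<Longrightarrow> f i < f (i + 1)"
    and gap_less: "\<And>i. i + 2 < N \<Longrightarrow> f (i + 1) - f i < f (i + 2) - f (i + 1)"
  shows "convex_finset (f ` {..<N})" and "card (f ` {..<N}) = N"
proof -
  have less: "f i < f j" if "i < j" "j < N" for i j
    using that
  proof (induction j)
    case (Suc j)
    then have "f j < f (Suc j)" using gap_pos[of j] by simp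
    with Suc show ?case by (cases "i = j") auto
  qed simp
  then have inj: "inj_on f {..<N}"
    by (metis inj_onI lessThan_iff linorder_neqE_nat order_less_irrefl)
  then show card: "card (f ` {..<N}) = N"
    by (simp add: card_image)
  have "sorted_wrt (<) (map f [0..<N])"
    using less by (simp add: sorted_wrt_iff_nth_less)
  then have "sorted_list_of_set (set (map f [0..<N])) = map f [0..<N]"
    by (simp add: strict_sorted_iff sorted_list_of_set.idem_if_sorted_distinct del: set_map)
  then have "sorted_list_of_set (f ` {..<N}) = map f [0..<N]"
    by (simp add: lessThan_atLeast0)
  then show "convex_finset (f ` {..<N})"
    unfolding convex_finset_def Let_def card using gap_less by simp
qed

text \<open>\<open>L\<close> is chosen above all |first differences| and |second differences| of
  \<open>q\<close> in range. Where a difference of \<open>p\<close> is at least 1,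
  \<open>L * p\<close> outweighs \<open>q\<close>; where the second difference of \<open>p\<close>
  vanishes, \<open>q\<close> alone decides. The threshold 1 suits integer-valued
  \<open>p\<close>.\<close>

lemma perturb_weakly_convex:
  fixes p q :: "nat \<Rightarrow> real"
  assumes gap: "\<And>i. i + 1 < N \<Longrightarrow> p (i + 1) - p i \<ge> 1"
    and second: "\<And>i. i + 2 < N \<Longrightarrow> p (i + 2) - 2 * p (i + 1) + p i \<ge> 1 \<or>
      p (i + 2) - 2 * p (i + 1) + p i = 0 \<and> q (i + 2) - 2 * q (i + 1) + q i > 0"
  obtains L where "L > 0"
    and "\<And>i. i + 1 < N \<Longrightarrow> L * p i + q i < L * p (i + 1) + q (i + 1)"
    and "\<And>i. i + 2 < N \<Longrightarrow> (L * p (i + 1) + q (i + 1)) - (L * p i + q i)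
           < (L * p (i + 2) + q (i + 2)) - (L * p (i + 1) + q (i + 1))"
proof -
  define w where "w i = \<bar>q (i + 1) - q i\<bar> + \<bar>q (i + 2) - 2 * q (i + 1) + q i\<bar>" for i
  define L where "L = 1 + sum w {..<N}"
  have w_nonneg: "w i \<ge> 0" for i by (simp add: w_def)
  have w_less: "w i < L" if "i < N" for i
    using member_le_sum[of i "{..<N}" w] that w_nonneg by (auto simp: L_def)
  have L: "L > 0"
    unfolding L_def using sum_nonneg[of "{..<N}" w] w_nonneg by (simp add: add_pos_nonneg)
  show thesis
  proof (rule that[OF L])
    fix i assume i: "i + 1 < N"
    have "L * 1 \<le> L * (p (i + 1) - p i)"
      by (rule mult_left_mono) (use gap[OF i] L in auto)
    moreover have "\<bar>q (i + 1) - q i\<bar> < L"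
      using w_less[of i] i unfolding w_def by linarith
    ultimately show "L * p i + q i < L * p (i + 1) + q (i + 1)"
      by (simp add: right_diff_distrib)
  next
    fix i assume i: "i + 2 < N"
    define D where "D = p (i + 2) - 2 * p (i + 1) + p i"
    define E where "E = q (i + 2) - 2 * q (i + 1) + q i"
    have "\<bar>E\<bar> < L" using w_less[of i] i unfolding w_def E_def by linarith
    have "L * D + E > 0"
    proof (cases "D \<ge> 1")
      case True
      have "L * 1 \<le> L * D" by (rule mult_left_mono) (use True L in auto)
      with \<open>\<bar>E\<bar> < L\<close> show ?thesis by linarith
    next
      case False
      then show ?thesis using second[OF i] by (auto simp: D_def E_def)
    qed
    then show "(L * p (i + 1) + q (i + 1)) - (L * p i + q i)
           < (L * p (i + 2) + q (i + 2)) - (L * p (i + 1) + q (i + 1))"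
      by (simp add: D_def E_def algebra_simps)
  qed
qed

section \<open>Runs of the arithmetic progressions and the walk through them\<close>

definition ratio :: "int \<Rightarrow> int \<Rightarrow> int" where
  "ratio n d = 8 * n\<^sup>2 div d"

text \<open>The run of \<open>d\<close> is entered from \<open>d - 1\<close> at the transition with
  t = \<open>ratio n (d - 1)\<close> and left for \<open>d + 1\<close> at the one with t =
  \<open>ratio n d\<close>, so its two ends belong to different t.\<close>

definition run_first :: "int \<Rightarrow> int \<Rightarrow> int" where
  "run_first n d = (d - 1) * ratio n (d - 1) + 1"

definition run_last :: "int \<Rightarrow> int \<Rightarrow> int" where
  "run_last n d = (d + 1) * ratio n d - 1"

primrec walk :: "int \<Rightarrow> nat \<Rightarrow> int \<times> int" where
  "walk n 0 = (run_first n (n + 1), n + 1)"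
| "walk n (Suc k) = (case walk n k of (u, d) \<Rightarrow>
     if u = run_last n d then (run_first n (d + 1), d + 1) else (u + 1, d))"

lemma mult_ratio_bounds:
  assumes "d > 0"
  shows "d * ratio n d \<le> 8 * n\<^sup>2" and "8 * n\<^sup>2 < d * ratio n d + d"
proof -
  have "8 * n\<^sup>2 = d * ratio n d + 8 * n\<^sup>2 mod d" by (simp add: ratio_def)
  moreover have "0 \<le> 8 * n\<^sup>2 mod d" "8 * n\<^sup>2 mod d < d" using assms by auto
  ultimately show "d * ratio n d \<le> 8 * n\<^sup>2" "8 * n\<^sup>2 < d * ratio n d + d" by linarith+
qed

lemma ratio_bounds:
  assumes "1 \<le> n" "n \<le> d" "d \<le> 2 * n"
  shows "4 * n \<le> ratio n d" and "ratio n d \<le> 8 * n"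
proof -
  have "4 * n * d \<le> 4 * n * (2 * n)"
    by (rule mult_left_mono) (use assms in auto)
  then have "(4 * n * d) div d \<le> 8 * n\<^sup>2 div d"
    by (intro zdiv_mono1) (use assms in \<open>auto simp: power2_eq_square\<close>)
  then show "4 * n \<le> ratio n d" using assms by (simp add: ratio_def)
  have "8 * n * n \<le> 8 * n * d"
    by (rule mult_left_mono) (use assms in auto)
  then have "8 * n\<^sup>2 div d \<le> (8 * n * d) div d"
    by (intro zdiv_mono1) (use assms in \<open>auto simp: power2_eq_square\<close>)
  then show "ratio n d \<le> 8 * n" using assms by (simp add: ratio_def)
qed

text \<open>Both \<open>d * ratio n d\<close> and \<open>(d - 1) * ratio n (d - 1)\<close> are
  within \<open>d\<close> of 8 n^2 and nearly cancel; what remains is about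
  \<open>ratio n d - d\<close>, at least 4 n - 2 n.\<close>

lemma run_length:
  assumes "1 \<le> n" "n + 1 \<le> d" "d \<le> 2 * n"
  shows "2 * n - 1 \<le> run_last n d - run_first n d"
proof -
  have "run_last n d - run_first n d
      = ratio n d + d * ratio n d - (d - 1) * ratio n (d - 1) - 2"
    by (simp add: run_last_def run_first_def algebra_simps)
  then show ?thesis
    using mult_ratio_bounds[of d n] mult_ratio_bounds[of "d - 1" n] ratio_bounds[of n d] assms
    by linarith
qed

text \<open>The last conjunct counts steps: at least 2 n for each completed run, plus the position
  in the current one. It forces \<open>d \<le> 2 * n\<close> as long as fewer than 2 n^2 steps are
  made.\<close>

lemma walk_invariant:
  assumes n: "1 \<le> n" and "walk n k = (u, d)" and "int k < 2 * n * n"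
  shows "n + 1 \<le> d \<and> d \<le> 2 * n \<and> run_first n d \<le> u \<and> u \<le> run_last n d \<and>
    2 * n * (d - n - 1) + (u - run_first n d) \<le> int k"
  using assms(2,3)
proof (induction k arbitrary: u d)
  case 0
  then show ?case using n run_length[of n "n + 1"] by auto
next
  case (Suc k)
  obtain u' d' where w: "walk n k = (u', d')" by force
  have IH: "n + 1 \<le> d'" "d' \<le> 2 * n" "run_first n d' \<le> u'" "u' \<le> run_last n d'"
    "2 * n * (d' - n - 1) + (u' - run_first n d') \<le> int k"
    using Suc.IH[OF w] Suc.prems by auto
  show ?case
  proof (cases "u' = run_last n d'")
    case False
    then show ?thesis using IH Suc.prems w by auto
  next
    case True
    then have ud: "u = run_first n (d' + 1)" "d = d' + 1" using Suc.prems w by auto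
    \<comment> \<open>The completed run has at least 2 n - 1 inner steps, and the transition adds
      one.\<close>
    have steps: "2 * n * (d' - n) \<le> int k + 1"
      using run_length[OF n IH(1,2)] IH(5) True by (simp add: algebra_simps)
    then have "2 * n * (d' - n) < 2 * n * n" using Suc.prems by simp
    then have "d \<le> 2 * n" using n ud by simp
    then show ?thesis using steps ud IH(1) n run_length[of n d] by auto
  qed
qed

lemma walk_range:
  assumes n: "1 \<le> n" and w: "walk n k = (u, d)" and k: "int k < 2 * n * n"
  shows "u \<in> {8 * n\<^sup>2 - 4 * n..8 * n\<^sup>2 + 8 * n}"
    and "u - d \<in> {8 * n\<^sup>2 - 4 * n..8 * n\<^sup>2 + 8 * n}"
proof -
  have inv: "n + 1 \<le> d" "d \<le> 2 * n" "run_first n d \<le> u" "u \<le> run_last n d"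
    using walk_invariant[OF n w k] by auto
  have "8 * n\<^sup>2 - 2 * n \<le> run_first n d"
    unfolding run_first_def using mult_ratio_bounds[of "d - 1" n] inv n by simp
  moreover have "run_last n d \<le> 8 * n\<^sup>2 + 8 * n"
    unfolding run_last_def distrib_right
    using mult_ratio_bounds[of d n] ratio_bounds[of n d] inv n by simp
  ultimately show "u \<in> {8 * n\<^sup>2 - 4 * n..8 * n\<^sup>2 + 8 * n}"
    and "u - d \<in> {8 * n\<^sup>2 - 4 * n..8 * n\<^sup>2 + 8 * n}"
    using inv n by auto
qed

section \<open>Gaps of the differences of squares and cubes along the walk\<close>

definition walk_diff :: "nat \<Rightarrow> int \<Rightarrow> nat \<Rightarrow> int" where
  "walk_diff e n k = (case walk n k of (u, d) \<Rightarrow> u ^ e - (u - d) ^ e)"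

text \<open>With t = \<open>ratio n d\<close>, both differences contain the term 2 d (d + 1) t,
  which cancels.\<close>

lemma run_transition_gap:
  "(run_first n (d + 1))\<^sup>2 - (run_first n (d + 1) - (d + 1))\<^sup>2
    = (run_last n d)\<^sup>2 - (run_last n d - d)\<^sup>2 + (2 * d + 1)"
  by (simp add: run_first_def run_last_def power2_eq_square algebra_simps)

lemma walk_diff_gap:
  assumes "walk n k = (u, d)"
  shows "walk_diff 2 n (k + 1) - walk_diff 2 n k = (if u = run_last n d then 2 * d + 1 else 2 * d)"
  using assms run_transition_gap[of n d]
  by (auto simp: walk_diff_def power2_eq_square algebra_simps)

text \<open>The gaps of the squares read 2 d, ..., 2 d, 2 d + 1, 2 d + 2, ..., so two neighbours
  agree only inside a run, and there the cubes decide.\<close>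

lemma walk_diff_second:
  assumes n: "1 \<le> n" and k: "int (k + 2) < 2 * n * n"
  shows "walk_diff 2 n (k + 2) - 2 * walk_diff 2 n (k + 1) + walk_diff 2 n k \<ge> 1 \<or>
    walk_diff 2 n (k + 2) - 2 * walk_diff 2 n (k + 1) + walk_diff 2 n k = 0 \<and>
    walk_diff 3 n (k + 2) - 2 * walk_diff 3 n (k + 1) + walk_diff 3 n k > 0"
proof -
  obtain u d where w: "walk n k = (u, d)" by force
  obtain u' d' where w': "walk n (k + 1) = (u', d')" by force
  have inv: "n + 1 \<le> d" and inv': "n + 1 \<le> d'" "d' \<le> 2 * n"
    using walk_invariant[OF n w] walk_invariant[OF n w'] k by auto
  have gaps: "walk_diff 2 n (k + 2) - 2 * walk_diff 2 n (k + 1) + walk_diff 2 n k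
      = (if u' = run_last n d' then 2 * d' + 1 else 2 * d')
        - (if u = run_last n d then 2 * d + 1 else 2 * d)"
    using walk_diff_gap[OF w] walk_diff_gap[OF w'] by (simp add: numeral_2_eq_2)
  consider (jump) "u = run_last n d" | (jump') "u \<noteq> run_last n d" "u' = run_last n d'"
    | (run) "u \<noteq> run_last n d" "u' \<noteq> run_last n d'" by blast
  then show ?thesis
  proof cases
    case jump
    then have "d' = d + 1" "u' = run_first n d'" using w w' by auto
    moreover have "run_first n d' \<noteq> run_last n d'"
      using run_length[OF n inv'] n by auto
    ultimately show ?thesis using gaps jump by auto
  next
    case jump'
    then have "d' = d" using w w' by auto
    then show ?thesis using gaps jump' by auto
  next
    case run
    then have ud': "d' = d" "u' = u + 1" using w w' by auto
    then have "walk n (k + 2) = (u + 2, d)" using run w' by (simp add: numeral_2_eq_2)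
    \<comment> \<open>For fixed \<open>d\<close>, u^3 - (u - d)^3 is quadratic in \<open>u\<close>
      with leading coefficient 3 d.\<close>
    then have "walk_diff 3 n (k + 2) - 2 * walk_diff 3 n (k + 1) + walk_diff 3 n k = 6 * d"
      using w w' ud' unfolding walk_diff_def
      by (simp add: power3_eq_cube algebra_simps)
    then show ?thesis using gaps run ud' inv n by auto
  qed
qed

section \<open>The set \<open>B\<close> and the final count\<close>

lemma large_convex_subset_of_sumset:
  assumes "1 \<le> m"
  obtains B A where "finite B" "m < card B" "card B \<le> 26 * m"
    "A \<subseteq> sumset B B" "convex_finset A" "card A = 2 * m\<^sup>2"
proof -
  define n where "n = int m"
  define N where "N = 2 * m\<^sup>2"
  have n: "1 \<le> n" using assms by (simp add: n_def)
  have "int N = 2 * n * n" by (simp add: N_def n_def power2_eq_square)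
  then have N: "i < N \<longleftrightarrow> int i < 2 * n * n" for i by linarith
  define p where "p k = real_of_int (walk_diff 2 n k)" for k
  define q where "q k = real_of_int (walk_diff 3 n k)" for k
  have gap: "p (i + 1) - p i \<ge> 1" if i: "i + 1 < N" for i
  proof -
    obtain u d where w: "walk n i = (u, d)" by force
    have "n + 1 \<le> d" using walk_invariant[OF n w] i N[of i] by auto
    then have "walk_diff 2 n (i + 1) - walk_diff 2 n i \<ge> 1"
      using walk_diff_gap[OF w] n by auto
    then show ?thesis unfolding p_def by linarith
  qed
  have second: "p (i + 2) - 2 * p (i + 1) + p i \<ge> 1 \<or>
      p (i + 2) - 2 * p (i + 1) + p i = 0 \<and> q (i + 2) - 2 * q (i + 1) + q i > 0"
    if i: "i + 2 < N" for i
    using walk_diff_second[OF n, of i] i unfolding N p_def q_def by linarith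
  obtain L where L: "L > 0"
    and incr: "\<And>i. i + 1 < N \<Longrightarrow> L * p i + q i < L * p (i + 1) + q (i + 1)"
    and conv: "\<And>i. i + 2 < N \<Longrightarrow> (L * p (i + 1) + q (i + 1)) - (L * p i + q i)
           < (L * p (i + 2) + q (i + 2)) - (L * p (i + 1) + q (i + 1))"
    using perturb_weakly_convex[of N p q] gap second by blast
  define g where "g u = L * (real_of_int u)\<^sup>2 + real_of_int u ^ 3" for u
  define I where "I = {8 * n\<^sup>2 - 4 * n..8 * n\<^sup>2 + 8 * n}"
  \<comment> \<open>Including the negatives turns the differences \<open>g u - g (u - d)\<close>
    into sums of two elements of \<open>B\<close>.\<close>
  define B where "B = g ` I \<union> (\<lambda>u. - g u) ` I"
  define A where "A = (\<lambda>k. L * p k + q k) ` {..<N}"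
  \<comment> \<open>This keeps \<open>I\<close> in the nonnegative integers, where \<open>g\<close>
    is strictly increasing because \<open>L > 0\<close>.\<close>
  have "n * 1 \<le> n * n" by (rule mult_left_mono) (use n in auto)
  then have I_nonneg: "u \<ge> 0" if "u \<in> I" for u
    using that n unfolding I_def power2_eq_square atLeastAtMost_iff by linarith
  have g_less: "g u < g v" if "0 \<le> u" "u < v" for u v
    unfolding g_def using that L
    by (intro add_strict_mono mult_strict_left_mono power_strict_mono) auto
  have "inj_on g I"
    by (rule linorder_inj_onI') (use g_less I_nonneg in force)
  then have card_g: "card (g ` I) = 12 * m + 1"
    by (simp add: card_image I_def n_def nat_add_distrib nat_mult_distrib)
  have fin: "finite B" by (simp add: B_def I_def)
  have "card (g ` I) \<le> card B"
    by (rule card_mono[OF fin]) (simp add: B_def)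
  then have lower: "m < card B" using card_g by simp
  have "(\<lambda>u. - g u) ` I = uminus ` (g ` I)" by auto
  then have "card ((\<lambda>u. - g u) ` I) = card (g ` I)" by (simp add: card_image)
  then have "card B \<le> 2 * card (g ` I)"
    unfolding B_def using card_Un_le[of "g ` I" "(\<lambda>u. - g u) ` I"] by simp
  \<comment> \<open>2 (12 m + 1) = 24 m + 2, and \<open>1 \<le> m\<close> absorbs the
    constant.\<close>
  then have upper: "card B \<le> 26 * m" using card_g assms by simp
  have sub: "A \<subseteq> sumset B B"
  proof
    fix x assume "x \<in> A"
    then obtain k where k: "k < N" "x = L * p k + q k" by (auto simp: A_def)
    obtain u d where w: "walk n k = (u, d)" by force
    have "u \<in> I" "u - d \<in> I"
      using walk_range[OF n w] k(1) unfolding N I_def by auto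
    moreover have "x = g u + - g (u - d)"
      using w by (simp add: k(2) p_def q_def walk_diff_def g_def algebra_simps)
    ultimately show "x \<in> sumset B B" unfolding sumset_def B_def by blast
  qed
  have "convex_finset A" "card A = 2 * m\<^sup>2"
    unfolding A_def using convex_finset_image[of N "\<lambda>k. L * p k + q k"] incr conv
    by (auto simp: N_def)
  with that fin lower upper sub show thesis by blast
qed

theorem theorem1:
  shows "\<exists>c::real. c > 0 \<and> (\<forall>m::nat. \<exists>B::real set.
           finite B \<and> card B > m \<and>
           (\<exists>A. A \<subseteq> sumset B B \<and> convex_finset A \<and> real (card A) \<ge> c * (real (card B))\<^sup>2))"
\<comment> \<open>1 / 338 = 2 / 26^2, from \<open>card A = 2 * m\<^sup>2\<close> and
  \<open>card B \<le> 26 * m\<close>. Below, \<open>m + 1\<close> stands for \<open>m\<close> so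
  that the case \<open>m = 0\<close> is covered.\<close>
proof (intro exI[of _ "1 / 338"] conjI allI)
  fix m :: nat
  obtain B A where BA: "finite B" "m + 1 < card B" "card B \<le> 26 * (m + 1)"
    "A \<subseteq> sumset B B" "convex_finset A" "card A = 2 * (m + 1)\<^sup>2"
    using large_convex_subset_of_sumset[of "m + 1"] by auto
  have "(real (card B))\<^sup>2 \<le> (real (26 * (m + 1)))\<^sup>2"
    using BA(3) by (intro power_mono) (simp_all only: of_nat_le_iff of_nat_0_le_iff)
  then have "1 / 338 * (real (card B))\<^sup>2 \<le> real (card A)"
    unfolding BA(6) by (simp add: power2_eq_square algebra_simps)
  with BA show "\<exists>B. finite B \<and> card B > m \<and> (\<exists>A. A \<subseteq> sumset B B \<and> convex_finset A \<and>
      real (card A) \<ge> 1 / 338 * (real (card B))\<^sup>2)"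
    by (metis add_lessD1)
qed simp

end
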